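(* Let $G$ be a connected graph of order $n\geq 3$ and let $k$ be an integer with $1\le k<\Delta(G)$. If $\delta(G)\ge k+1$, then $\gamma_k^{\mathrm L}(G)\geq \gamma_{1,\,\delta(G)-k}(G)$.
   Context: All graphs are finite, simple and undirected; $\delta(G)$ and $\Delta(G)$ are the minimum and maximum degree and $N(v)$ is the open neighborhood of $v$. A dominating set of $G$ is a set $D\subseteq V(G)$ such that every vertex not in $D$ has a neighbor in $D$. For an integer $0\le k\le \Delta(G)$, a set $D\subseteq V(G)$ is a $k$-limited dominating set if $D$ is a dominating set and $|N(u)-D|\le k$ for every $u\in D$. $\gamma_k^{\mathrm L}(G)$ is the minimum cardinality of a $k$-limited dominating set of $G$. For an integer $t\ge 1$ and a graph $G$ with $\delta(G)\ge t$, a set $S\subseteq V(G)$ is a $(1,t)$-dominating set if every vertex in $V(G)-S$ has at least one neighbor in $S$ and every vertex in $S$ has at least $t$ neighbors in $S$; $\gamma_{1,t}(G)$ is the minimum cardinality of a $(1,t)$-dominating set. *)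

theory Defs
  imports "Graph_Theory.Graph_Theory"
begin

text \<open>
  A finite simple undirected graph is modelled by the locale \<^locale>\<open>graph\<close>: a finite symmetric
  digraph without loops and parallel arcs, so that each edge \<open>uv\<close> is the pair of arcs
  \<open>u \<rightarrow> v\<close>, \<open>v \<rightarrow> u\<close>. The definitions below are meant for such digraphs only.
\<close>

definition neighborhood :: "('a, 'b) pre_digraph \<Rightarrow> 'a \<Rightarrow> 'a set" where
  "neighborhood G v = {u \<in> verts G. v \<rightarrow>\<^bsub>G\<^esub> u}"

text \<open>Each edge at \<open>v\<close> contributes exactly one outgoing arc, so the degree is the out-degree.\<close>

definition min_degree :: "('a, 'b) pre_digraph \<Rightarrow> nat" where
  "min_degree G = Min (out_degree G ` verts G)"

definition max_degree :: "('a, 'b) pre_digraph \<Rightarrow> nat" where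
  "max_degree G = Max (out_degree G ` verts G)"

lemma (in digraph) out_degree_eq_card_neighborhood:
  "out_degree G v = card (neighborhood G v)"
proof -
  have "neighborhood G v = head G ` out_arcs G v"
    by (auto simp: neighborhood_def arcs_ends_conv)
  moreover have "inj_on (head G) (out_arcs G v)"
    by (auto intro!: inj_onI no_multi_arcs simp: arc_to_ends_def)
  ultimately show ?thesis
    by (simp add: out_degree_def card_image)
qed

definition dominating_set :: "('a, 'b) pre_digraph \<Rightarrow> 'a set \<Rightarrow> bool" where
  "dominating_set G D \<longleftrightarrow>
     D \<subseteq> verts G \<and> (\<forall>v \<in> verts G - D. \<exists>u \<in> D. u \<in> neighborhood G v)"

definition limited_dominating_set :: "('a, 'b) pre_digraph \<Rightarrow> nat \<Rightarrow> 'a set \<Rightarrow> bool" where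
  "limited_dominating_set G k D \<longleftrightarrow>
     dominating_set G D \<and> (\<forall>u \<in> D. card (neighborhood G u - D) \<le> k)"

text \<open>
  The vertex set itself is a \<open>k\<close>-limited dominating set for every \<open>k\<close>, so the minimum is taken
  over a nonempty finite set.
\<close>

definition limited_domination_number :: "('a, 'b) pre_digraph \<Rightarrow> nat \<Rightarrow> nat" where
  "limited_domination_number G k = Min (card ` {D. limited_dominating_set G k D})"

definition one_t_dominating_set :: "('a, 'b) pre_digraph \<Rightarrow> nat \<Rightarrow> 'a set \<Rightarrow> bool" where
  "one_t_dominating_set G t S \<longleftrightarrow>
     S \<subseteq> verts G \<and>
     (\<forall>v \<in> verts G - S. 1 \<le> card (neighborhood G v \<inter> S)) \<and>
     (\<forall>v \<in> S. t \<le> card (neighborhood G v \<inter> S))"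

text \<open>
  Only meaningful for \<open>1 \<le> t \<le> min_degree G\<close>; then the vertex set is a \<open>(1,t)\<close>-dominating set,
  whereas for larger \<open>t\<close> there may be none and the \<^const>\<open>Min\<close> is unspecified.
\<close>

definition one_t_domination_number :: "('a, 'b) pre_digraph \<Rightarrow> nat \<Rightarrow> nat" where
  "one_t_domination_number G t = Min (card ` {S. one_t_dominating_set G t S})"

end

theory Submission
  imports Defs
begin

text \<open>
  The neighbors of a vertex \<open>u\<close> are split by a set \<open>D\<close> into those inside and those outside \<open>D\<close>.
  There are at least \<open>\<delta>(G)\<close> of them in total, so if at most \<open>k\<close> lie outside then at least
  \<open>\<delta>(G) - k\<close> lie inside. Hence every \<open>k\<close>-limited dominating set is already a
  \<open>(1, \<delta>(G) - k)\<close>-dominating set, and a minimum over a larger family of sets is no larger.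
\<close>

context digraph
begin

lemma finite_neighborhood: "finite (neighborhood G v)"
  by (simp add: neighborhood_def)

lemma min_degree_le_card_neighborhood:
  assumes "v \<in> verts G"
  shows "min_degree G \<le> card (neighborhood G v)"
  using assms by (simp add: min_degree_def flip: out_degree_eq_card_neighborhood)

text \<open>
  Inside \<open>D\<close>, the degree bound is counted across the split of the neighborhood by \<open>D\<close>; outside
  \<open>D\<close>, both notions ask for domination.
\<close>

lemma limited_dominating_set_imp_one_t_dominating_set:
  assumes "limited_dominating_set G k D"
  shows "one_t_dominating_set G (min_degree G - k) D"
  unfolding one_t_dominating_set_def
proof (intro conjI ballI)
  show sub: "D \<subseteq> verts G"
    using assms by (simp add: limited_dominating_set_def dominating_set_def)
  show "1 \<le> card (neighborhood G v \<inter> D)" if "v \<in> verts G - D" for v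
  proof -
    have "neighborhood G v \<inter> D \<noteq> {}"
      using assms that by (auto simp: limited_dominating_set_def dominating_set_def)
    then show ?thesis
      by (simp add: Suc_le_eq card_gt_0_iff finite_neighborhood)
  qed
  show "min_degree G - k \<le> card (neighborhood G v \<inter> D)" if "v \<in> D" for v
  proof -
    have "card (neighborhood G v - D) \<le> k"
      using assms that by (simp add: limited_dominating_set_def)
    moreover have "min_degree G \<le> card (neighborhood G v)"
      using sub that by (auto intro: min_degree_le_card_neighborhood)
    moreover have "card (neighborhood G v) =
        card (neighborhood G v \<inter> D) + card (neighborhood G v - D)"
      by (rule card_Int_Diff[OF finite_neighborhood])
    ultimately show ?thesis by linarith
  qed
qed

lemma limited_dominating_set_verts: "limited_dominating_set G k (verts G)"
proof -
  have "card (neighborhood G v - verts G) = 0" for v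
    by (auto simp: neighborhood_def)
  then show ?thesis
    by (simp only: limited_dominating_set_def dominating_set_def) simp
qed

lemma finite_one_t_dominating_sets: "finite {S. one_t_dominating_set G t S}"
  by (rule finite_subset[of _ "Pow (verts G)"]) (auto simp: one_t_dominating_set_def)

lemma one_t_domination_number_le_limited_domination_number:
  "one_t_domination_number G (min_degree G - k) \<le> limited_domination_number G k"
  unfolding one_t_domination_number_def limited_domination_number_def
proof (rule Min_antimono)
  show "card ` {D. limited_dominating_set G k D}
      \<subseteq> card ` {S. one_t_dominating_set G (min_degree G - k) S}"
    using limited_dominating_set_imp_one_t_dominating_set by blast
  \<comment> \<open>The minimum over an empty family would be unspecified; the vertex set rules this out.\<close>
  show "card ` {D. limited_dominating_set G k D} \<noteq> {}"
    using limited_dominating_set_verts by blast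
  show "finite (card ` {S. one_t_dominating_set G (min_degree G - k) S})"
    by (simp add: finite_one_t_dominating_sets)
qed

end

theorem proposition9:
  fixes G :: "('a, 'b) pre_digraph" and k :: nat
  assumes "graph G"
    and "connected G"
    and "card (verts G) \<ge> 3"
    and "1 \<le> k" and "k < max_degree G"
    and "min_degree G \<ge> k + 1"
  shows "limited_domination_number G k \<ge> one_t_domination_number G (min_degree G - k)"
proof -
  interpret graph G by (rule assms(1))
  show ?thesis by (rule one_t_domination_number_le_limited_domination_number)
qed

end
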